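(* Let $G_1$ and $G_2$ be finite simple undirected graphs on $n$ vertices, with $m_1$ and $m_2$ edges respectively, where $m_2=2m_1$. Let $p,k$ be integers with $k\ge 4$, $p\ge 4n+k$ and $m_2\le\frac{k(4n+k)}{8}-n$. Then $$LE\big(D[G_1^*]\vee\overline{K_p}\big)=LE\big(G_2^{**}\vee\overline{K_p}\big).$$
   Context: The Laplacian energy of a graph $H$ with $N$ vertices, $M$ edges and Laplacian eigenvalues $\nu_1,\dots,\nu_N$ (eigenvalues of $D-A$, with $A$ the adjacency matrix and $D$ the diagonal degree matrix) is $LE(H)=\sum_{i=1}^N|\nu_i-\frac{2M}{N}|$. The double graph $D[G]$ is obtained by taking two copies of $G$ and joining each vertex in one copy with the neighbours of the corresponding vertex in the other copy; i.e. it has vertex set $V(G)\times\{1,2\}$ with $(u,a)$ adjacent to $(v,b)$ iff $u$ is adjacent to $v$ in $G$. For $G$ with vertex set $\{v_1,\dots,v_n\}$, the extended double cover $G^*$ is the bipartite graph with parts $X=\{x_1,\dots,x_n\}$, $Y=\{y_1,\dots,y_n\}$, where $x_i$ is adjacent to $y_j$ iff $i=j$ or $v_i$ is adjacent to $v_j$ in $G$; $G^{**}=(G^* )^*$. The join $H_1\vee H_2$ is the disjoint union of $H_1$ and $H_2$ together with all edges between $V(H_1)$ and $V(H_2)$. $\overline{K_p}$ is the edgeless graph on $p$ vertices. *)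

theory Defs
  imports
    "Graph_Theory.Graph_Theory"
    "Jordan_Normal_Form.Char_Poly"
begin

text \<open>
  A finite simple undirected graph is a \<^locale>\<open>pair_graph\<close>: a finite vertex set with a
  symmetric, irreflexive arc relation. Every undirected edge is represented by two
  opposite arcs, so edges are counted as unordered pairs.
\<close>

definition num_edges :: "'a pair_pre_digraph \<Rightarrow> nat" where
  "num_edges G = card {{u, v} | u v. (u, v) \<in> parcs G}"

text \<open>
  Matrices are indexed by positions, so the vertices have to be listed; \<open>xs\<close> is meant to
  enumerate \<^term>\<open>pverts G\<close> without repetition.
\<close>

definition adjacency_matrix :: "'a pair_pre_digraph \<Rightarrow> 'a list \<Rightarrow> real mat" where
  "adjacency_matrix G xs =
     mat (length xs) (length xs) (\<lambda>(i, j). if (xs ! i, xs ! j) \<in> parcs G then 1 else 0)"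

definition degree_matrix :: "'a pair_pre_digraph \<Rightarrow> 'a list \<Rightarrow> real mat" where
  "degree_matrix G xs = mat_diag (length xs) (\<lambda>i. real (out_degree (with_proj G) (xs ! i)))"

definition laplacian_matrix :: "'a pair_pre_digraph \<Rightarrow> 'a list \<Rightarrow> real mat" where
  "laplacian_matrix G xs = degree_matrix G xs - adjacency_matrix G xs"

text \<open>
  The multiset of Laplacian eigenvalues, with algebraic multiplicity. The Laplacian matrix is
  real symmetric, so all its eigenvalues are real. The choice of the enumeration is
  irrelevant, see \<open>laplacian_spectrum_eq\<close> below.
\<close>

definition laplacian_spectrum :: "'a pair_pre_digraph \<Rightarrow> real multiset" where
  "laplacian_spectrum G =
     proots (char_poly (laplacian_matrix G (SOME xs. distinct xs \<and> set xs = pverts G)))"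

definition laplacian_energy :: "'a pair_pre_digraph \<Rightarrow> real" where
  "laplacian_energy G =
     (\<Sum>\<nu>\<in>#laplacian_spectrum G. \<bar>\<nu> - 2 * real (num_edges G) / real (card (pverts G))\<bar>)"

definition double_graph :: "'a pair_pre_digraph \<Rightarrow> ('a \<times> bool) pair_pre_digraph" where
  "double_graph G =
     \<lparr> pverts = pverts G \<times> UNIV,
       parcs = {((u, a), (v, b)) | u a v b. (u, v) \<in> parcs G} \<rparr>"

text \<open>The part \<open>X\<close> consists of the vertices \<^term>\<open>Inl v\<close>, the part \<open>Y\<close> of the vertices \<^term>\<open>Inr v\<close>.\<close>

definition extended_double_cover :: "'a pair_pre_digraph \<Rightarrow> ('a + 'a) pair_pre_digraph" where
  "extended_double_cover G =
     (let E = {(u, v). u \<in> pverts G \<and> v \<in> pverts G \<and> (u = v \<or> (u, v) \<in> parcs G)} in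
      \<lparr> pverts = Inl ` pverts G \<union> Inr ` pverts G,
        parcs = {(Inl u, Inr v) | u v. (u, v) \<in> E} \<union> {(Inr v, Inl u) | u v. (u, v) \<in> E} \<rparr>)"

definition graph_join ::
  "'a pair_pre_digraph \<Rightarrow> 'b pair_pre_digraph \<Rightarrow> ('a + 'b) pair_pre_digraph" where
  "graph_join G H =
     \<lparr> pverts = Inl ` pverts G \<union> Inr ` pverts H,
       parcs = {(Inl u, Inl v) | u v. (u, v) \<in> parcs G} \<union>
               {(Inr u, Inr v) | u v. (u, v) \<in> parcs H} \<union>
               {(Inl u, Inr v) | u v. u \<in> pverts G \<and> v \<in> pverts H} \<union>
               {(Inr v, Inl u) | u v. u \<in> pverts G \<and> v \<in> pverts H} \<rparr>"

definition edgeless_graph :: "nat \<Rightarrow> nat pair_pre_digraph" where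
  "edgeless_graph p = \<lparr> pverts = {..<p}, parcs = {} \<rparr>"

lemma pair_graphI:
  assumes "finite (pverts G)" "parcs G \<subseteq> pverts G \<times> pverts G"
    and "sym (parcs G)" "irrefl (parcs G)"
  shows "pair_graph G"
proof
  show "finite (parcs G)"
    using assms(1,2) by (meson finite_SigmaI finite_subset)
  show "symmetric (with_proj G)"
    using assms(3) by (simp add: symmetric_def)
qed (use assms in \<open>auto simp: irrefl_def\<close>)

lemma pair_graph_double_graph:
  assumes "pair_graph G"
  shows "pair_graph (double_graph G)"
proof -
  interpret pair_graph G by fact
  show ?thesis
    by (rule pair_graphI)
       (auto simp: double_graph_def sym_def irrefl_def pair_finite_verts
             dest: in_arcsD1 in_arcsD2 arcs_symmetric no_loops')
qed

lemma pair_graph_extended_double_cover: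
  assumes "pair_graph G"
  shows "pair_graph (extended_double_cover G)"
proof -
  interpret pair_graph G by fact
  show ?thesis
    by (rule pair_graphI)
       (auto simp: extended_double_cover_def sym_def irrefl_def pair_finite_verts)
qed

lemma pair_graph_graph_join:
  assumes "pair_graph G" "pair_graph H"
  shows "pair_graph (graph_join G H)"
proof -
  interpret G: pair_graph G by fact
  interpret H: pair_graph H by fact
  show ?thesis
    by (rule pair_graphI)
       (auto simp: graph_join_def sym_def irrefl_def G.pair_finite_verts H.pair_finite_verts
             dest: G.in_arcsD1 G.in_arcsD2 G.arcs_symmetric G.no_loops'
                   H.in_arcsD1 H.in_arcsD2 H.arcs_symmetric H.no_loops')
qed

lemma pair_graph_edgeless_graph: "pair_graph (edgeless_graph p)"
  by (rule pair_graphI) (auto simp: edgeless_graph_def sym_def irrefl_def)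

lemma det_permute_both:
  fixes A :: "'a :: comm_ring_1 mat"
  assumes A: "A \<in> carrier_mat n n" and f: "f permutes {0..<n}"
  shows "Determinant.det (mat n n (\<lambda>(i, j). A $$ (f i, f j))) = Determinant.det A"
proof -
  let ?R = "mat n n (\<lambda>(i, j). A $$ (f i, j))"
  let ?B = "mat n n (\<lambda>(i, j). A $$ (f i, f j))"
  have fi: "f i < n" if "i < n" for i
    using permutes_in_image[OF f, of i] that by auto
  have "transpose_mat ?B = mat n n (\<lambda>(i, j). transpose_mat ?R $$ (f i, j))"
    by (rule eq_matI) (auto simp: fi)
  then have "Determinant.det (transpose_mat ?B) = signof f * Determinant.det (transpose_mat ?R)"
    using det_permute_rows[of "transpose_mat ?R" n f] f by simp
  moreover have "Determinant.det ?R = signof f * Determinant.det A"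
    using det_permute_rows[OF A f] by simp
  moreover have "Determinant.det (transpose_mat ?B) = Determinant.det ?B"
    by (rule det_transpose[of _ n]) auto
  moreover have "Determinant.det (transpose_mat ?R) = Determinant.det ?R"
    by (rule det_transpose[of _ n]) auto
  moreover have "(signof f :: 'a) * (signof f * Determinant.det A) = Determinant.det A"
    by (simp add: sign_def)
  ultimately show ?thesis by simp
qed

lemma char_poly_laplacian_matrix_cong:
  assumes "distinct xs" "distinct ys" "set xs = set ys"
  shows "char_poly (laplacian_matrix G xs) = char_poly (laplacian_matrix G ys)"
proof -
  define n where "n = length xs"
  have len: "length ys = n"
    using assms by (metis distinct_card n_def)
  have "mset ys = mset xs"
    using assms set_eq_iff_mset_eq_distinct by metis
  then obtain f where f: "f permutes {..<length xs}" "permute_list f xs = ys"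
    by (rule mset_eq_permutation)
  have perm: "f permutes {0..<n}"
    using f(1) by (simp add: n_def atLeast0LessThan)
  have fi: "f i < n" if "i < n" for i
    using permutes_in_image[OF perm, of i] that by auto
  have nth: "ys ! i = xs ! f i" if "i < n" for i
    using f that permute_list_nth[of f xs i] by (auto simp: n_def)
  have inj: "f i = f j \<longleftrightarrow> i = j" for i j
    using permutes_inj[OF perm] by (auto dest: injD)
  let ?A = "char_poly_matrix (laplacian_matrix G xs)"
  have A: "?A \<in> carrier_mat n n"
    unfolding laplacian_matrix_def degree_matrix_def adjacency_matrix_def n_def
    by (intro char_poly_matrix_closed minus_carrier_mat) simp
  have "char_poly_matrix (laplacian_matrix G ys) = mat n n (\<lambda>(i, j). ?A $$ (f i, f j))"
    by (rule eq_matI)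
       (auto simp: char_poly_matrix_def laplacian_matrix_def degree_matrix_def
          adjacency_matrix_def mat_diag_def len n_def[symmetric] fi nth inj)
  then show ?thesis
    using det_permute_both[OF A perm] by (simp add: char_poly_def)
qed

lemma laplacian_spectrum_eq:
  assumes "distinct xs" "set xs = pverts G"
  shows "laplacian_spectrum G = proots (char_poly (laplacian_matrix G xs))"
proof -
  let ?ys = "SOME xs. distinct xs \<and> set xs = pverts G"
  have "distinct ?ys \<and> set ?ys = pverts G"
    by (rule someI[of _ xs]) (use assms in simp)
  then show ?thesis
    using char_poly_laplacian_matrix_cong[of ?ys xs G] assms
    by (simp add: laplacian_spectrum_def)
qed

end

theory Submission
  imports Defs "Jordan_Normal_Form.Schur_Decomposition"
begin

text \<open>
  Let \<open>H\<close> have \<open>N > 0\<close> vertices and \<open>M\<close> edges, and let \<open>d = 2(M + Np)/(N + p)\<close> be the average degree of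
  its join with \<open>p > 0\<close> isolated vertices. The Laplacian spectrum of the join consists of \<open>0\<close>,
  \<open>N + p\<close>, \<open>N\<close> with multiplicity \<open>p - 1\<close>, and the numbers \<open>p + \<mu>\<close>, where \<open>\<mu>\<close> runs through the spectrum
  of \<open>H\<close> with one eigenvalue \<open>0\<close> removed (\<open>laplacian_spectrum_join_edgeless\<close>). Laplacian eigenvalues are
  nonnegative, so if \<open>d \<le> p\<close>, the absolute values \<open>\<bar>p + \<mu> - d\<bar>\<close> can be dropped, and as the \<open>\<mu>\<close> add up
  to the trace \<open>2M\<close> of the Laplacian matrix, the energy of the join depends on \<open>N\<close>, \<open>M\<close> and \<open>p\<close> only
  (\<open>laplacian_energy_join_edgeless\<close>).

  The condition \<open>d \<le> p\<close> amounts to \<open>2M \<le> p(p - N)\<close>. Both graphs in question have \<open>N = 4n\<close> vertices,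
  and both have \<open>M = 4n + 4m\<^sub>2\<close> edges because \<open>m\<^sub>2 = 2m\<^sub>1\<close>. Since \<open>p \<ge> 4n + k\<close> gives
  \<open>p(p - N) \<ge> (4n + k)k\<close>, the upper bound on \<open>m\<^sub>2\<close> is just what the condition requires.

  The spectrum of the join is obtained from its characteristic polynomial: \<open>xI - L\<close> is a block matrix
  whose off-diagonal blocks are all ones, with one diagonal block scalar and the other of constant row
  sums, and \<open>det_four_block_ones\<close> evaluates such determinants. That \<open>H\<close> has \<open>N\<close> real eigenvalues with sum \<open>2M\<close>
  follows from the reality of the eigenvalues of a symmetric matrix and from Schur triangularization
  (\<open>char_poly_laplacian_factorization\<close>).
\<close>

section \<open>Determinants with all-ones blocks\<close>

definition ones :: "nat \<Rightarrow> nat \<Rightarrow> 'a :: one mat" where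
  "ones n m = mat n m (\<lambda>_. 1)"

lemma ones_carrier [simp]: "ones n m \<in> carrier_mat n m"
  by (simp add: ones_def)

lemma ones_dim [simp]: "dim_row (ones n m) = n" "dim_col (ones n m) = m"
  by (simp_all add: ones_def)

lemma ones_index [simp]: "i < n \<Longrightarrow> j < m \<Longrightarrow> ones n m $$ (i, j) = 1"
  by (simp add: ones_def)

text \<open>
  The rank-one case of the matrix determinant lemma, for \<open>bI + cJ\<close>: bordering the matrix by one row and
  one column gives a matrix that has a block triangular factorization in two ways, one for each choice
  of the pivot block.
\<close>

lemma det_scalar_plus_ones:
  fixes b c :: "'a :: field"
  assumes "b \<noteq> 0"
  shows "b * Determinant.det (b \<cdot>\<^sub>m 1\<^sub>m n + c \<cdot>\<^sub>m ones n n) = b ^ n * (b + of_nat n * c)"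
proof -
  let ?B = "b \<cdot>\<^sub>m 1\<^sub>m n + c \<cdot>\<^sub>m ones n n"
  let ?M = "four_block_mat (1\<^sub>m 1) ((-c) \<cdot>\<^sub>m ones 1 n) (ones n 1) (b \<cdot>\<^sub>m 1\<^sub>m n)"
  let ?L1 = "four_block_mat (1\<^sub>m 1) (0\<^sub>m 1 n) (ones n 1) (1\<^sub>m n)"
  let ?U1 = "four_block_mat (1\<^sub>m 1) ((-c) \<cdot>\<^sub>m ones 1 n) (0\<^sub>m n 1) ?B"
  let ?U2 = "four_block_mat ((1 + of_nat n * c / b) \<cdot>\<^sub>m 1\<^sub>m 1) ((-c / b) \<cdot>\<^sub>m ones 1 n) (0\<^sub>m n 1) (1\<^sub>m n)"
  let ?L2 = "four_block_mat (1\<^sub>m 1) (0\<^sub>m 1 n) (ones n 1) (b \<cdot>\<^sub>m 1\<^sub>m n)"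
  have 1: "?M = ?L1 * ?U1"
    by (subst mult_four_block_mat[of _ 1 1 _ n _ n])
       (auto simp: scalar_prod_def intro!: cong_four_block_mat eq_matI)
  have TL: "(1 + of_nat n * c / b) \<cdot>\<^sub>m 1\<^sub>m 1 + ((-c / b) \<cdot>\<^sub>m ones 1 n) * ones n 1 = 1\<^sub>m 1"
    by (rule eq_matI) (auto simp: scalar_prod_def)
  have TR: "((-c / b) \<cdot>\<^sub>m ones 1 n) * (b \<cdot>\<^sub>m 1\<^sub>m n) = (-c) \<cdot>\<^sub>m ones 1 n"
    using assms by (subst mult_smult_distrib[of _ 1 n _ n]) (auto intro!: eq_matI)
  have 2: "?M = ?U2 * ?L2"
    by (subst mult_four_block_mat[of _ 1 1 _ n _ n]) (use TL TR in auto)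
  have "Determinant.det ?M = Determinant.det ?L1 * Determinant.det ?U1"
    unfolding 1 by (rule det_mult[of _ "1 + n"]) auto
  also have "(Determinant.det ?L1 :: 'a) = 1"
    using det_four_block_mat_upper_right_zero[of "1\<^sub>m 1" 1 "0\<^sub>m 1 n" n "ones n 1" "1\<^sub>m n"] by simp
  also have "Determinant.det ?U1 = Determinant.det ?B"
    using det_four_block_mat_lower_left_zero[of "1\<^sub>m 1" 1 "(-c) \<cdot>\<^sub>m ones 1 n" n _ ?B] by simp
  finally have M1: "Determinant.det ?M = Determinant.det ?B" by simp
  have "Determinant.det ?M = Determinant.det ?U2 * Determinant.det ?L2"
    unfolding 2 by (rule det_mult[of _ "1 + n"]) auto
  also have "Determinant.det ?U2 = 1 + of_nat n * c / b"
    using det_four_block_mat_lower_left_zero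
        [of "(1 + of_nat n * c / b) \<cdot>\<^sub>m 1\<^sub>m 1" 1 "(-c / b) \<cdot>\<^sub>m ones 1 n" n _ "1\<^sub>m n"] by simp
  also have "Determinant.det ?L2 = b ^ n"
    using det_four_block_mat_upper_right_zero
        [of "1\<^sub>m 1" 1 "0\<^sub>m 1 n" n "ones n 1" "b \<cdot>\<^sub>m 1\<^sub>m n"] by simp
  finally show ?thesis
    using assms M1 by (simp add: field_simps)
qed

text \<open>
  As the rows of \<open>A\<close> sum to \<open>a\<close>, the all-ones matrix \<open>J\<close> satisfies \<open>A (J/a) = J\<close>. Hence \<open>A\<close> can be
  split off as a left factor; the remaining block matrix has an identity block as pivot, and its Schur
  complement \<open>bI - (n/a)J\<close> is again a combination of \<open>I\<close> and \<open>J\<close>.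
\<close>

lemma det_four_block_ones:
  fixes A :: "'a :: field mat"
  assumes A: "A \<in> carrier_mat n n"
    and row_sums: "\<And>i. i < n \<Longrightarrow> (\<Sum>j<n. A $$ (i, j)) = a"
    and "a \<noteq> 0" "b \<noteq> 0"
  shows "a * b * Determinant.det (four_block_mat A (ones n p) (ones p n) (b \<cdot>\<^sub>m 1\<^sub>m p)) =
         b ^ p * Determinant.det A * (a * b - of_nat n * of_nat p)"
proof -
  let ?M = "four_block_mat A (ones n p) (ones p n) (b \<cdot>\<^sub>m 1\<^sub>m p)"
  let ?K = "four_block_mat (1\<^sub>m n) ((1 / a) \<cdot>\<^sub>m ones n p) (ones p n) (b \<cdot>\<^sub>m 1\<^sub>m p)"
  let ?B = "b \<cdot>\<^sub>m 1\<^sub>m p + (- of_nat n / a) \<cdot>\<^sub>m ones p p"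
  let ?D = "four_block_mat A (0\<^sub>m n p) (0\<^sub>m p n) (1\<^sub>m p)"
  let ?L = "four_block_mat (1\<^sub>m n) (0\<^sub>m n p) (ones p n) (1\<^sub>m p)"
  let ?U = "four_block_mat (1\<^sub>m n) ((1 / a) \<cdot>\<^sub>m ones n p) (0\<^sub>m p n) ?B"
  have AJ: "A * ((1 / a) \<cdot>\<^sub>m ones n p) = ones n p"
    using assms
    by (intro eq_matI)
       (auto simp: scalar_prod_def atLeast0LessThan sum_divide_distrib[symmetric])
  have 1: "?M = ?D * ?K"
    using A
    by (subst mult_four_block_mat[of _ n n _ p _ p])
       (auto simp: AJ intro!: cong_four_block_mat)
  have 2: "?K = ?L * ?U"
    by (subst mult_four_block_mat[of _ n n _ p _ p])
       (auto simp: scalar_prod_def intro!: cong_four_block_mat eq_matI)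
  have "Determinant.det ?M = Determinant.det ?D * Determinant.det ?K"
    unfolding 1 using A by (intro det_mult[of _ "n + p"]) auto
  also have "Determinant.det ?K = Determinant.det ?L * Determinant.det ?U"
    unfolding 2 by (rule det_mult[of _ "n + p"]) auto
  also have "Determinant.det ?D = Determinant.det A"
    using A by (subst det_four_block_mat_upper_right_zero[of _ n _ p]) auto
  also have "(Determinant.det ?L :: 'a) = 1"
    using det_four_block_mat_upper_right_zero[of "1\<^sub>m n" n "0\<^sub>m n p" p "ones p n" "1\<^sub>m p"] by simp
  also have "Determinant.det ?U = Determinant.det ?B"
    using det_four_block_mat_lower_left_zero[of "1\<^sub>m n" n "(1 / a) \<cdot>\<^sub>m ones n p" p _ ?B] by simp
  finally have "Determinant.det ?M = Determinant.det A * Determinant.det ?B" by simp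
  then have "a * b * Determinant.det ?M = a * Determinant.det A * (b * Determinant.det ?B)"
    by simp
  also have "b * Determinant.det ?B = b ^ p * (b + of_nat p * (- of_nat n / a))"
    by (rule det_scalar_plus_ones) fact
  also have "a * Determinant.det A * (b ^ p * (b + of_nat p * (- of_nat n / a))) =
      b ^ p * Determinant.det A * (a * (b + of_nat p * (- of_nat n / a)))"
    by (simp only: mult_ac)
  also have "a * (b + of_nat p * (- of_nat n / a)) = a * b - of_nat n * of_nat p"
    using \<open>a \<noteq> 0\<close> by (simp add: right_diff_distrib mult.commute)
  finally show ?thesis .
qed

section \<open>Eigenvalues of real symmetric matrices\<close>

text \<open>
  Over the complex numbers every polynomial splits, and the roots are real: if \<open>Av = av\<close>, then the
  Hermitian form \<open>v\<^sup>* A v = a \<parallel>v\<parallel>\<^sup>2\<close> equals its own conjugate. The factorization therefore descends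
  to the reals.
\<close>

lemma symmetric_char_poly_splits:
  fixes A :: "real mat"
  assumes A: "A \<in> carrier_mat n n"
    and sym: "\<And>i j. i < n \<Longrightarrow> j < n \<Longrightarrow> A $$ (i, j) = A $$ (j, i)"
  shows "\<exists>es. char_poly A = (\<Prod>e\<leftarrow>es. [:- e, 1:])"
proof -
  let ?C = "map_mat complex_of_real A"
  have C: "?C \<in> carrier_mat n n" using A by simp
  have real_root: "a \<in> \<real>" if root: "poly (char_poly ?C) a = 0" for a
  proof -
    from root have "eigenvalue ?C a"
      using eigenvalue_root_char_poly[OF C] by simp
    then obtain v where v: "v \<in> carrier_vec n" "v \<noteq> 0\<^sub>v n" "?C *\<^sub>v v = a \<cdot>\<^sub>v v"
      using C by (auto simp: eigenvalue_def eigenvector_def)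
    have row: "(\<Sum>j<n. of_real (A $$ (i, j)) * v $ j) = a * v $ i" if "i < n" for i
    proof -
      have "(?C *\<^sub>v v) $ i = (a \<cdot>\<^sub>v v) $ i" using v by simp
      then show ?thesis
        using that v(1) A by (simp add: scalar_prod_def atLeast0LessThan)
    qed
    define q where "q = (\<Sum>i<n. \<Sum>j<n. cnj (v $ i) * of_real (A $$ (i, j)) * v $ j)"
    define s where "s = (\<Sum>i<n. (cmod (v $ i))\<^sup>2)"
    have "q = (\<Sum>i<n. cnj (v $ i) * (a * v $ i))"
      unfolding q_def
      by (intro sum.cong refl) (simp add: row[symmetric] sum_distrib_left mult.assoc)
    also have "\<dots> = a * of_real s"
      by (simp add: s_def sum_distrib_left complex_norm_square mult_ac del: of_real_power)
    finally have q: "q = a * of_real s" .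
    have "cnj q = (\<Sum>i<n. \<Sum>j<n. cnj (v $ j) * of_real (A $$ (i, j)) * v $ i)"
      by (simp add: q_def mult_ac)
    also have "\<dots> = (\<Sum>j<n. \<Sum>i<n. cnj (v $ j) * of_real (A $$ (i, j)) * v $ i)"
      by (rule sum.swap)
    also have "\<dots> = q"
      unfolding q_def by (intro sum.cong refl) (auto simp: sym)
    finally have "cnj q = q" .
    moreover have "s \<noteq> 0"
    proof
      assume "s = 0"
      then have "\<forall>i<n. v $ i = 0"
        by (auto simp: s_def sum_nonneg_eq_0_iff)
      then show False using v(1,2) by (metis carrier_vecD eq_vecI index_zero_vec)
    qed
    ultimately have "cnj a = a" by (simp add: q)
    then show ?thesis by (simp add: Reals_cnj_iff)
  qed
  obtain as where as: "char_poly ?C = (\<Prod>a\<leftarrow>as. [:- a, 1:])"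
    using char_poly_factorized[OF C] by blast
  have "a \<in> \<real>" if "a \<in> set as" for a
    using that real_root by (simp add: as poly_prod_list prod_list_zero_iff image_iff)
  then have "map complex_of_real (map Re as) = as"
    by (auto intro!: map_idI)
  interpret of_real_poly: map_poly_inj_idom_hom complex_of_real ..
  have "map_poly complex_of_real (\<Prod>e\<leftarrow>map Re as. [:- e, 1:])
      = (\<Prod>a\<leftarrow>map complex_of_real (map Re as). [:- a, 1:])"
    by (simp add: of_real_poly.hom_prod_list o_def)
  also have "\<dots> = map_poly complex_of_real (char_poly A)"
    unfolding \<open>map complex_of_real (map Re as) = as\<close> as[symmetric]
    by (rule of_real_hom.char_poly_hom[OF A])
  finally have "char_poly A = (\<Prod>e\<leftarrow>map Re as. [:- e, 1:])"
    using of_real_poly.injectivity by metis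
  then show ?thesis by blast
qed

text \<open>
  The trace is invariant under similarity, and the Schur form of \<open>A\<close> has the eigenvalues on its
  diagonal.
\<close>

lemma sum_diag_eq_sum_eigenvalues:
  fixes A :: "real mat"
  assumes A: "A \<in> carrier_mat n n" and es: "char_poly A = (\<Prod>e\<leftarrow>es. [:- e, 1:])"
  shows "(\<Sum>i<n. A $$ (i, i)) = sum_list es"
proof -
  obtain B P Q where "schur_decomposition A es = (B, P, Q)"
    by (cases "schur_decomposition A es")
  then have wit: "similar_mat_wit A B P Q" and diag: "diag_mat B = es"
    using schur_decomposition[OF A es] by auto
  note w = similar_mat_witD2[OF A wit]
  have B: "B \<in> carrier_mat n n" and P: "P \<in> carrier_mat n n" and Q: "Q \<in> carrier_mat n n"
    using w by auto
  have trace_comm: "(\<Sum>i<n. (X * Y) $$ (i, i)) = (\<Sum>i<n. (Y * X) $$ (i, i))"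
    if "X \<in> carrier_mat n n" "Y \<in> carrier_mat n n" for X Y :: "real mat"
  proof -
    have "(\<Sum>i<n. (X * Y) $$ (i, i)) = (\<Sum>i<n. \<Sum>j<n. X $$ (i, j) * Y $$ (j, i))"
      using that by (simp add: scalar_prod_def atLeast0LessThan)
    also have "\<dots> = (\<Sum>j<n. \<Sum>i<n. X $$ (i, j) * Y $$ (j, i))"
      by (rule sum.swap)
    also have "\<dots> = (\<Sum>i<n. (Y * X) $$ (i, i))"
      using that by (simp add: scalar_prod_def atLeast0LessThan mult.commute)
    finally show ?thesis .
  qed
  have "Q * (P * B) = B"
    using assoc_mult_mat[OF Q P B] w B by simp
  then have "(\<Sum>i<n. A $$ (i, i)) = (\<Sum>i<n. B $$ (i, i))"
    using trace_comm[of "P * B" Q] w P Q B by simp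
  also have "\<dots> = sum_list es"
    using B by (simp add: diag[symmetric] diag_mat_def sum_list_sum_nth atLeast0LessThan)
  finally show ?thesis .
qed

section \<open>The Laplacian matrix and its eigenvalues\<close>

lemma sum_lessThan_add:
  fixes f :: "nat \<Rightarrow> 'a :: comm_monoid_add"
  shows "(\<Sum>i<m + n. f i) = (\<Sum>i<m. f i) + (\<Sum>i<n. f (m + i))"
  by (induction n) (simp_all add: add.assoc)

lemma sum_nth_distinct:
  assumes "distinct xs"
  shows "(\<Sum>i<length xs. f (xs ! i)) = (\<Sum>x\<in>set xs. f x)"
  by (rule sum.reindex_bij_betw) (use assms in \<open>auto intro: bij_betw_nth\<close>)

lemma adjacency_matrix_dim [simp]:
  "dim_row (adjacency_matrix G xs) = length xs" "dim_col (adjacency_matrix G xs) = length xs"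
  by (simp_all add: adjacency_matrix_def)

lemma adjacency_matrix_index:
  "i < length xs \<Longrightarrow> j < length xs \<Longrightarrow>
     adjacency_matrix G xs $$ (i, j) = (if (xs ! i, xs ! j) \<in> parcs G then 1 else 0)"
  by (simp add: adjacency_matrix_def)

lemma laplacian_matrix_carrier [simp]:
  "laplacian_matrix G xs \<in> carrier_mat (length xs) (length xs)"
  unfolding laplacian_matrix_def degree_matrix_def adjacency_matrix_def
  by (intro minus_carrier_mat) simp

lemma laplacian_matrix_dim [simp]:
  "dim_row (laplacian_matrix G xs) = length xs" "dim_col (laplacian_matrix G xs) = length xs"
  using laplacian_matrix_carrier by blast+

lemma out_degree_eq_row_sum:
  assumes "pair_graph G" "distinct xs" "set xs = pverts G" "i < length xs"
  shows "real (out_degree (with_proj G) (xs ! i)) = (\<Sum>j<length xs. adjacency_matrix G xs $$ (i, j))"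
proof -
  interpret pair_graph G by fact
  let ?u = "xs ! i"
  have "out_arcs (with_proj G) ?u = Pair ?u ` {v \<in> pverts G. (?u, v) \<in> parcs G}"
    by (auto simp: out_arcs_def image_iff dest: in_arcsD2)
  then have "real (out_degree (with_proj G) ?u) = card {v \<in> pverts G. (?u, v) \<in> parcs G}"
    by (simp add: out_degree_def card_image inj_on_def)
  also have "\<dots> = (\<Sum>v\<in>set xs. if (?u, v) \<in> parcs G then 1 else 0)"
    by (simp add: sum.If_cases assms(3) pair_finite_verts Collect_conj_eq Int_commute)
  also have "\<dots> = (\<Sum>j<length xs. if (?u, xs ! j) \<in> parcs G then 1 else 0)"
    by (rule sum_nth_distinct[symmetric]) fact
  also have "\<dots> = (\<Sum>j<length xs. adjacency_matrix G xs $$ (i, j))"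
    using assms(4) by (intro sum.cong) (auto simp: adjacency_matrix_index)
  finally show ?thesis .
qed

text \<open>
  With the degrees written as row sums of the adjacency matrix, the Laplacian matrix of a join can be
  read off from the block form of its adjacency matrix alone.
\<close>

lemma laplacian_matrix_index:
  assumes "pair_graph G" "distinct xs" "set xs = pverts G" "i < length xs" "j < length xs"
  shows "laplacian_matrix G xs $$ (i, j) =
    (if i = j then \<Sum>k<length xs. adjacency_matrix G xs $$ (i, k) else 0)
      - adjacency_matrix G xs $$ (i, j)"
  using assms out_degree_eq_row_sum[OF assms(1-4)]
  by (auto simp: laplacian_matrix_def degree_matrix_def mat_diag_def)

lemma adjacency_matrix_sym:
  assumes "pair_graph G" "i < length xs" "j < length xs"
  shows "adjacency_matrix G xs $$ (i, j) = adjacency_matrix G xs $$ (j, i)"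
proof -
  interpret pair_graph G by fact
  show ?thesis
    using assms(2,3) arcs_symmetric by (auto simp: adjacency_matrix_index)
qed

lemma laplacian_row_sum:
  assumes "pair_graph G" "distinct xs" "set xs = pverts G" "i < length xs"
  shows "(\<Sum>j<length xs. laplacian_matrix G xs $$ (i, j)) = 0"
  using assms by (simp add: laplacian_matrix_index sum_subtractf)

text \<open>
  If \<open>Lv = ev\<close>, then \<open>e \<parallel>v\<parallel>\<^sup>2\<close> is the value of the Laplacian quadratic form at \<open>v\<close>, which is a sum of
  squares: \<open>v\<^sup>T L v = 1/2 \<Sum>\<^sub>i\<^sub>j A\<^sub>i\<^sub>j (v\<^sub>i - v\<^sub>j)\<^sup>2\<close>.
\<close>

lemma laplacian_eigenvalue_nonneg:
  assumes G: "pair_graph G" and xs: "distinct xs" "set xs = pverts G"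
    and ev: "eigenvalue (laplacian_matrix G xs) e"
  shows "e \<ge> 0"
proof -
  let ?L = "laplacian_matrix G xs" and ?n = "length xs"
  define A where "A = (\<lambda>i j. adjacency_matrix G xs $$ (i, j))"
  obtain v where v: "v \<in> carrier_vec ?n" "v \<noteq> 0\<^sub>v ?n" "?L *\<^sub>v v = e \<cdot>\<^sub>v v"
    using ev by (auto simp: eigenvalue_def eigenvector_def)
  have row: "e * v $ i = (\<Sum>j<?n. A i j * (v $ i - v $ j))" if "i < ?n" for i
  proof -
    have "e * v $ i = (?L *\<^sub>v v) $ i" using v that by simp
    also have "\<dots> = (\<Sum>j<?n. ?L $$ (i, j) * v $ j)"
      using that v(1) by (simp add: scalar_prod_def atLeast0LessThan)
    also have "\<dots> = (\<Sum>j<?n. (if i = j then (\<Sum>k<?n. A i k) * v $ j else 0) - A i j * v $ j)"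
      by (intro sum.cong refl)
         (use that in \<open>simp add: laplacian_matrix_index[OF G xs] A_def left_diff_distrib\<close>)
    also have "\<dots> = (\<Sum>j<?n. A i j * (v $ i - v $ j))"
      using that by (simp add: sum_subtractf sum_distrib_right right_diff_distrib)
    finally show ?thesis .
  qed
  have sym: "A i j = A j i" if "i < ?n" "j < ?n" for i j
    unfolding A_def by (rule adjacency_matrix_sym[OF G that])
  define q where "q = (\<Sum>i<?n. \<Sum>j<?n. A i j * (v $ i - v $ j) * v $ i)"
  have "q = (\<Sum>i<?n. e * v $ i * v $ i)"
    unfolding q_def by (intro sum.cong refl) (simp add: row sum_distrib_right)
  then have q: "q = e * (\<Sum>i<?n. (v $ i)\<^sup>2)"
    by (simp add: sum_distrib_left power2_eq_square mult.assoc)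
  \<comment> \<open>Averaging \<open>q\<close> over both orders of the indices turns it into a sum of squares.\<close>
  have "q = (\<Sum>j<?n. \<Sum>i<?n. A i j * (v $ i - v $ j) * v $ i)"
    unfolding q_def by (rule sum.swap)
  also have "\<dots> = (\<Sum>j<?n. \<Sum>i<?n. A j i * (v $ i - v $ j) * v $ i)"
    by (intro sum.cong refl) (simp add: sym)
  finally have "2 * q = (\<Sum>i<?n. \<Sum>j<?n. A i j * (v $ i - v $ j)\<^sup>2)"
    unfolding mult_2 by (subst (1) q_def)
      (simp add: sum.distrib[symmetric] power2_eq_square algebra_simps)
  moreover have "A i j \<ge> 0" if "i < ?n" "j < ?n" for i j
    using that by (simp add: A_def adjacency_matrix_index)
  ultimately have "q \<ge> 0"
    by (smt (verit) lessThan_iff sum_nonneg mult_nonneg_nonneg zero_le_power2)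
  moreover have "(\<Sum>i<?n. (v $ i)\<^sup>2) > 0"
  proof -
    obtain i where "i < ?n" "v $ i \<noteq> 0"
      using v(1,2) by (metis carrier_vecD eq_vecI index_zero_vec)
    then show ?thesis by (intro sum_pos2[of _ i]) auto
  qed
  ultimately show ?thesis by (simp add: q zero_le_mult_iff)
qed

lemma laplacian_trace:
  assumes G: "pair_graph G" and xs: "distinct xs" "set xs = pverts G"
  shows "(\<Sum>i<length xs. laplacian_matrix G xs $$ (i, i)) = real (card (parcs G))"
proof -
  interpret pair_graph G by fact
  define arc :: "_ \<Rightarrow> _ \<Rightarrow> real" where "arc = (\<lambda>u v. if (u, v) \<in> parcs G then 1 else 0)"
  have "(\<Sum>i<length xs. laplacian_matrix G xs $$ (i, i)) =
        (\<Sum>i<length xs. \<Sum>k<length xs. adjacency_matrix G xs $$ (i, k))"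
    using no_loops' by (intro sum.cong refl)
      (auto simp: laplacian_matrix_index[OF assms] adjacency_matrix_index)
  also have "\<dots> = (\<Sum>i<length xs. \<Sum>k<length xs. arc (xs ! i) (xs ! k))"
    by (intro sum.cong refl) (simp add: adjacency_matrix_index arc_def)
  also have "\<dots> = (\<Sum>u\<in>pverts G. \<Sum>v\<in>pverts G. arc u v)"
    using sum_nth_distinct[OF xs(1), of "\<lambda>u. \<Sum>v\<in>pverts G. arc u v"]
    by (simp add: sum_nth_distinct[OF xs(1)] xs(2))
  also have "\<dots> = (\<Sum>a\<in>pverts G \<times> pverts G. if a \<in> parcs G then 1 else 0)"
    by (simp add: sum.cartesian_product case_prod_unfold arc_def)
  also have "\<dots> = real (card (pverts G \<times> pverts G \<inter> parcs G))"
    by (simp add: sum.If_cases pair_finite_verts)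
  also have "pverts G \<times> pverts G \<inter> parcs G = parcs G"
    by (auto dest: in_arcsD1 in_arcsD2)
  finally show ?thesis .
qed

lemma card_parcs_eq_twice_num_edges:
  assumes "pair_graph G"
  shows "card (parcs G) = 2 * num_edges G"
proof -
  interpret pair_graph G by fact
  let ?e = "\<lambda>(u, v). {u, v}"
  have fibre: "card {a \<in> parcs G. ?e a = e} = 2" if "e \<in> ?e ` parcs G" for e
  proof -
    from that obtain u v where uv: "(u, v) \<in> parcs G" "e = {u, v}" by auto
    have "{a \<in> parcs G. ?e a = e} = {(u, v), (v, u)}"
    proof (intro equalityI subsetI)
      fix a assume "a \<in> {a \<in> parcs G. ?e a = e}"
      then have "{fst a, snd a} = {u, v}" using uv(2) by (simp add: case_prod_unfold)
      then show "a \<in> {(u, v), (v, u)}" by (cases a) (simp add: doubleton_eq_iff)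
    next
      fix a assume "a \<in> {(u, v), (v, u)}"
      then show "a \<in> {a \<in> parcs G. ?e a = e}"
        using uv arcs_symmetric[OF uv(1)] by (elim insertE emptyE) (simp_all add: insert_commute)
    qed
    moreover have "u \<noteq> v" using uv no_loops' by auto
    ultimately show ?thesis by simp
  qed
  have "card (parcs G) = (\<Sum>e\<in>?e ` parcs G. card {a \<in> parcs G. ?e a = e})"
    using sum.image_gen[OF pair_finite_arcs, of "\<lambda>_. 1 :: nat" ?e] by simp
  also have "\<dots> = 2 * card (?e ` parcs G)"
    using fibre by simp
  also have "?e ` parcs G = {{u, v} | u v. (u, v) \<in> parcs G}"
    by force
  finally show ?thesis by (simp add: num_edges_def)
qed

text \<open>
  Individual eigenvalues do not matter for the energy of a join of average degree at most \<open>p\<close> with \<open>p\<close>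
  isolated vertices; their number, sum and sign suffice. The sum is the trace, which counts every edge at both of its ends.
\<close>

lemma char_poly_laplacian_factorization:
  assumes G: "pair_graph G" and xs: "distinct xs" "set xs = pverts G"
  obtains es where
    "char_poly (laplacian_matrix G xs) = (\<Prod>e\<leftarrow>es. [:- e, 1:])"
    "length es = card (pverts G)" "sum_list es = 2 * real (num_edges G)"
    "\<And>e. e \<in> set es \<Longrightarrow> e \<ge> 0"
proof -
  let ?L = "laplacian_matrix G xs" and ?n = "length xs"
  have "?L $$ (i, j) = ?L $$ (j, i)" if "i < ?n" "j < ?n" for i j
    using that adjacency_matrix_sym[OF G that] by (simp add: laplacian_matrix_index[OF assms])
  then obtain es where es: "char_poly ?L = (\<Prod>e\<leftarrow>es. [:- e, 1:])"
    using symmetric_char_poly_splits[OF laplacian_matrix_carrier] by blast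
  have "length es = degree (char_poly ?L)"
    using degree_linear_factors[of uminus es] by (simp add: es)
  then have len: "length es = card (pverts G)"
    using degree_monic_char_poly[of ?L ?n] distinct_card[of xs] xs by simp
  have "e \<ge> 0" if "e \<in> set es" for e
  proof -
    have "poly (char_poly ?L) e = 0"
      using that by (auto simp: es poly_prod_list prod_list_zero_iff)
    then show ?thesis
      using laplacian_eigenvalue_nonneg[OF assms] eigenvalue_root_char_poly by force
  qed
  with es len show thesis
    using that laplacian_trace[OF assms] card_parcs_eq_twice_num_edges[OF G]
      sum_diag_eq_sum_eigenvalues[OF laplacian_matrix_carrier es]
    by simp
qed

section \<open>Counting vertices and edges\<close>

lemma num_edges_double_graph:
  fixes G :: "'a pair_pre_digraph"
  assumes G: "pair_graph G"
  shows "num_edges (double_graph G) = 4 * num_edges G"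
proof -
  let ?f = "\<lambda>((u :: 'a, v :: 'a), (a :: bool, b :: bool)). ((u, a), (v, b))"
  have "parcs (double_graph G) = ?f ` (parcs G \<times> (UNIV :: (bool \<times> bool) set))"
    unfolding double_graph_def by (auto simp: image_def Bex_def)
  moreover have "inj_on ?f (parcs G \<times> UNIV)" by (auto simp: inj_on_def)
  moreover have "card (UNIV :: (bool \<times> bool) set) = 4"
    by (simp add: UNIV_Times_UNIV[symmetric] card_cartesian_product del: UNIV_Times_UNIV)
  ultimately have "card (parcs (double_graph G)) = 4 * card (parcs G)"
    by (simp add: card_image card_cartesian_product)
  then show ?thesis
    using card_parcs_eq_twice_num_edges[OF G] card_parcs_eq_twice_num_edges[OF pair_graph_double_graph[OF G]] by simp
qed

lemma card_pverts_extended_double_cover: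
  fixes G :: "'a pair_pre_digraph"
  assumes "pair_graph G"
  shows "card (pverts (extended_double_cover G)) = 2 * card (pverts G)"
proof -
  interpret pair_graph G by fact
  have "pverts (extended_double_cover G) = (Inl ` pverts G :: ('a + 'a) set) \<union> Inr ` pverts G"
    by (simp add: extended_double_cover_def Let_def)
  also have "card \<dots> = card (Inl ` pverts G :: ('a + 'a) set) + card (Inr ` pverts G :: ('a + 'a) set)"
    using pair_finite_verts by (subst card_Un_disjoint) auto
  finally show ?thesis by (simp add: card_image)
qed

lemma num_edges_extended_double_cover:
  fixes G :: "'a pair_pre_digraph"
  assumes G: "pair_graph G"
  shows "num_edges (extended_double_cover G) = card (pverts G) + 2 * num_edges G"
proof -
  interpret pair_graph G by fact
  define E where "E = Id_on (pverts G) \<union> parcs G"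
  have "card (Id_on (pverts G)) = card (pverts G)"
    unfolding Id_on_def by (simp add: UNION_singleton_eq_range card_image inj_on_def)
  then have E: "finite E" "card E = card (pverts G) + card (parcs G)"
    unfolding E_def using no_loops' pair_finite_verts pair_finite_arcs
    by (auto simp: Id_on_def intro!: card_Un_disjoint[THEN trans])
  let ?XY = "(\<lambda>(u, v). (Inl u, Inr v)) ` E :: (('a + 'a) \<times> ('a + 'a)) set"
    and ?YX = "(\<lambda>(u, v). (Inr v, Inl u)) ` E :: (('a + 'a) \<times> ('a + 'a)) set"
  have "parcs (extended_double_cover G) = ?XY \<union> ?YX"
    by (auto simp: extended_double_cover_def E_def image_iff dest: in_arcsD1 in_arcsD2)
  also have "card \<dots> = card ?XY + card ?YX"
    using E by (subst card_Un_disjoint) auto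
  also have "\<dots> = 2 * card E"
    by (subst (1 2) card_image) (auto simp: inj_on_def)
  finally show ?thesis
    using E card_parcs_eq_twice_num_edges[OF G] card_parcs_eq_twice_num_edges[OF pair_graph_extended_double_cover[OF G]] by simp
qed

lemma num_edges_join_edgeless:
  fixes G :: "'a pair_pre_digraph"
  assumes G: "pair_graph G"
  shows "num_edges (graph_join G (edgeless_graph p)) = num_edges G + card (pverts G) * p"
proof -
  interpret pair_graph G by fact
  let ?GG = "(\<lambda>(u, v). (Inl u, Inl v)) ` parcs G :: (('a + nat) \<times> ('a + nat)) set"
    and ?GK = "(\<lambda>(u, v). (Inl u, Inr v)) ` (pverts G \<times> {..<p}) :: (('a + nat) \<times> ('a + nat)) set"
    and ?KG = "(\<lambda>(u, v). (Inr v, Inl u)) ` (pverts G \<times> {..<p}) :: (('a + nat) \<times> ('a + nat)) set"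
  have fin: "finite (parcs G)" "finite (pverts G \<times> {..<p})"
    using pair_finite_arcs pair_finite_verts by auto
  have "parcs (graph_join G (edgeless_graph p)) = ?GG \<union> (?GK \<union> ?KG)"
    by (auto simp: graph_join_def edgeless_graph_def image_iff)
  also have "card \<dots> = card ?GG + card (?GK \<union> ?KG)"
    using fin by (subst card_Un_disjoint) auto
  also have "card (?GK \<union> ?KG) = card ?GK + card ?KG"
    using fin by (subst card_Un_disjoint) auto
  also have "card ?GG + (card ?GK + card ?KG) = card (parcs G) + 2 * (card (pverts G) * p)"
    by (subst (1 2 3) card_image) (auto simp: inj_on_def card_cartesian_product)
  finally show ?thesis
    using card_parcs_eq_twice_num_edges[OF G]
      card_parcs_eq_twice_num_edges[OF pair_graph_graph_join[OF G pair_graph_edgeless_graph[of p]]] by simp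
qed

section \<open>Joins with edgeless graphs\<close>

text \<open>
  In the join every vertex of \<open>G\<close> gains \<open>p\<close> neighbours and every new vertex has all vertices of \<open>G\<close> as
  its neighbours. The first contributes the shift from \<open>t\<close> to \<open>t - p\<close>, the second the scalar block.
  (\<open>char_matrix A t\<close> is \<open>A - tI\<close>, whence the signs.)
\<close>

lemma char_matrix_laplacian_join_edgeless:
  fixes t :: real and p :: nat
  assumes G: "pair_graph G" and xs: "distinct xs" "set xs = pverts G"
  defines "J \<equiv> graph_join G (edgeless_graph p)"
    and "zs \<equiv> map Inl xs @ map Inr [0..<p]"
  shows "- char_matrix (laplacian_matrix J zs) t =
    four_block_mat (- char_matrix (laplacian_matrix G xs) (t - real p))
      (ones (length xs) p) (ones p (length xs)) ((t - real (length xs)) \<cdot>\<^sub>m 1\<^sub>m p)"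
proof -
  let ?n = "length xs"
  have J: "pair_graph J"
    unfolding J_def by (rule pair_graph_graph_join[OF G pair_graph_edgeless_graph])
  have zs: "distinct zs" "set zs = pverts J" "length zs = ?n + p"
    using xs by (auto simp: zs_def J_def graph_join_def edgeless_graph_def distinct_map lessThan_atLeast0)
  have verts: "xs ! i \<in> pverts G" if "i < ?n" for i
    using nth_mem[OF that] xs(2) by simp
  have arcs_J: "(Inl u, Inl v) \<in> parcs J \<longleftrightarrow> (u, v) \<in> parcs G"
      "(Inl u, Inr k) \<in> parcs J \<longleftrightarrow> u \<in> pverts G \<and> k < p"
      "(Inr k, Inl u) \<in> parcs J \<longleftrightarrow> u \<in> pverts G \<and> k < p"
      "(Inr k, Inr l) \<notin> parcs J" for u v k l
    by (auto simp: J_def graph_join_def edgeless_graph_def)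
  have adj: "adjacency_matrix J zs =
    four_block_mat (adjacency_matrix G xs) (ones ?n p) (ones p ?n) (0\<^sub>m p p)"
  proof (rule eq_matI)
    fix i j
    assume "i < dim_row (four_block_mat (adjacency_matrix G xs) (ones ?n p) (ones p ?n) (0\<^sub>m p p))"
      and "j < dim_col (four_block_mat (adjacency_matrix G xs) (ones ?n p) (ones p ?n) (0\<^sub>m p p))"
    then have ij: "i < ?n + p" "j < ?n + p" by simp_all
    then have lhs: "adjacency_matrix J zs $$ (i, j) = (if (zs ! i, zs ! j) \<in> parcs J then 1 else 0)"
      by (simp add: adjacency_matrix_index zs(3))
    show "adjacency_matrix J zs $$ (i, j) =
        four_block_mat (adjacency_matrix G xs) (ones ?n p) (ones p ?n) (0\<^sub>m p p) $$ (i, j)"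
      unfolding lhs using ij
      by (cases "i < ?n"; cases "j < ?n")
         (simp_all add: zs_def nth_append arcs_J verts adjacency_matrix_index)
  qed (simp_all add: zs(3))
  have deg_low: "(\<Sum>k<?n + p. adjacency_matrix J zs $$ (i, k)) =
      (\<Sum>k<?n. adjacency_matrix G xs $$ (i, k)) + real p" if "i < ?n" for i
    using that by (simp add: adj sum_lessThan_add)
  have deg_high: "(\<Sum>k<?n + p. adjacency_matrix J zs $$ (i, k)) = real ?n"
    if "?n \<le> i" "i < ?n + p" for i
  proof -
    have "\<not> i < ?n" "i - ?n < p" using that by auto
    then show ?thesis using that by (simp add: adj sum_lessThan_add)
  qed
  have L: "laplacian_matrix J zs $$ (i, j) =
    (if i = j then if i < ?n then (\<Sum>k<?n. adjacency_matrix G xs $$ (i, k)) + real p else real ?n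
     else 0) - adjacency_matrix J zs $$ (i, j)"
    if "i < ?n + p" "j < ?n + p" for i j
    using that by (simp add: laplacian_matrix_index[OF J zs(1,2)] zs(3) deg_low deg_high)
  show ?thesis
    by (rule eq_matI)
       (auto simp: char_matrix_def zs(3) L adj laplacian_matrix_index[OF G xs])
qed

lemma proots_linear_factors:
  fixes f :: "'b \<Rightarrow> 'a :: idom"
  shows "proots (\<Prod>e\<leftarrow>es. [:- f e, 1:]) = mset (map f es)"
proof (induction es)
  case (Cons e es)
  have "(\<Prod>e\<leftarrow>es. [:- f e, 1:]) \<noteq> 0"
    by (auto simp: prod_list_zero_iff)
  then show ?case
    using Cons by (simp add: proots_mult del: mult_pCons_left)
qed simp

text \<open>
  If \<open>G\<close> has vertices, the all-ones vector is an eigenvector of its Laplacian matrix with eigenvalue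
  \<open>0\<close>; the shifted eigenvalue \<open>p\<close> is the only one that the join does not inherit. Adding \<open>p\<close> on the left-hand side
  replaces the removal of this eigenvalue on the right and gives an equation that is also true if \<open>G\<close> has
  no vertices.
\<close>

lemma laplacian_spectrum_join_edgeless:
  assumes G: "pair_graph G" and "p > 0"
  shows "add_mset (real p) (laplacian_spectrum (graph_join G (edgeless_graph p))) =
    {#0, real (card (pverts G)) + real p#} + replicate_mset (p - 1) (real (card (pverts G))) +
    image_mset (\<lambda>\<mu>. real p + \<mu>) (laplacian_spectrum G)"
proof -
  interpret pair_graph G by fact
  let ?J = "graph_join G (edgeless_graph p)"
  obtain xs where xs: "distinct xs" "set xs = pverts G"
    using finite_distinct_list[OF pair_finite_verts] by blast
  define zs where "zs = map Inl xs @ map Inr [0..<p]"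
  define n where "n = length xs"
  have n: "card (pverts G) = n"
    using distinct_card[OF xs(1)] xs(2) by (simp add: n_def)
  have zs: "distinct zs" "set zs = pverts ?J"
    using xs by (auto simp: zs_def graph_join_def edgeless_graph_def distinct_map lessThan_atLeast0)
  let ?L = "laplacian_matrix G xs"
  define \<chi> where "\<chi> = char_poly (laplacian_matrix ?J zs)"
  have L: "?L \<in> carrier_mat n n" by (simp add: n_def)
  obtain es where es: "char_poly ?L = (\<Prod>e\<leftarrow>es. [:- e, 1:])"
    using char_poly_laplacian_factorization[OF G xs] by metis
  have eval: "(t - p) * (t - n) * poly \<chi> t =
      (t - n) ^ p * poly (char_poly ?L) (t - p) * ((t - p) * (t - n) - real n * real p)"
    if t: "t \<noteq> p" "t \<noteq> n" for t :: real
  proof -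
    let ?A = "- char_matrix ?L (t - p)"
    have A: "?A \<in> carrier_mat n n" using L by simp
    have "(\<Sum>j<n. ?A $$ (i, j)) = t - p" if "i < n" for i
    proof -
      have "(\<Sum>j<n. ?A $$ (i, j)) = (\<Sum>j<n. (if i = j then t - p else 0) - ?L $$ (i, j))"
        by (intro sum.cong refl) (use that in \<open>simp add: char_matrix_def n_def[symmetric]\<close>)
      then show ?thesis
        using that laplacian_row_sum[OF G xs, of i] by (simp add: sum_subtractf n_def)
    qed
    moreover have "poly \<chi> t = Determinant.det
        (four_block_mat ?A (ones n p) (ones p n) ((t - n) \<cdot>\<^sub>m 1\<^sub>m p))"
      unfolding \<chi>_def char_poly_matrix[OF laplacian_matrix_carrier] zs_def n_def
      by (subst char_matrix_laplacian_join_edgeless[OF G xs]) simp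
    ultimately show ?thesis
      using det_four_block_ones[OF A, of "t - p" "t - n" p] t
      by (simp add: char_poly_matrix[OF L])
  qed
  define lin where "lin = (\<lambda>a :: real. [:- a, 1:])"
  have poly_lin: "poly (lin a) t = t - a" and lin_nonzero: "lin a \<noteq> 0"
    and proots_lin: "proots (lin a) = {#a#}" for a t
    by (simp_all add: lin_def)
  define R where "R = (\<Prod>e\<leftarrow>es. lin (p + e))"
  have R: "proots R = mset (map (\<lambda>e. p + e) es)" "R \<noteq> 0"
    using proots_linear_factors[of "\<lambda>e. p + e" es] by (auto simp: R_def lin_def prod_list_zero_iff)
  have shift: "poly (char_poly ?L) (t - p) = poly R t" for t :: real
    unfolding es R_def lin_def by (induction es) (simp_all add: algebra_simps)
  let ?rhs = "lin 0 * lin (real n + real p) * lin n ^ (p - 1) * R"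
  \<comment> \<open>The determinant formula holds for \<open>t\<close> other than \<open>p\<close> and \<open>n\<close>; the two extra factors make both sides vanish there.\<close>
  have "lin p * lin n * (lin p * \<chi>) = lin p * lin n * ?rhs"
  proof (intro poly_eq_poly_eq_iff[THEN iffD1] ext)
    fix t :: real
    show "poly (lin p * lin n * (lin p * \<chi>)) t = poly (lin p * lin n * ?rhs) t"
    proof (cases "t = p \<or> t = n")
      case True
      then show ?thesis by (auto simp: poly_lin)
    next
      case False
      have "(t - p) * (t - n) * ((t - p) * poly \<chi> t) =
            (t - p) * ((t - p) * (t - n) * poly \<chi> t)"
        by (simp only: mult_ac)
      also have "(t - p) * (t - n) * poly \<chi> t =
          (t - n) ^ p * poly R t * ((t - p) * (t - n) - real n * real p)"
        using False eval[of t] by (simp only: shift) simp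
      also have "(t - p) * (t - n) - real n * real p = t * (t - (real n + real p))"
        by (simp add: algebra_simps)
      also have "(t - n) ^ p = (t - n) * (t - n) ^ (p - 1)"
        using \<open>p > 0\<close> by (simp add: power_eq_if)
      finally show ?thesis
        by (simp add: poly_lin poly_power mult_ac)
    qed
  qed
  then have "lin p * \<chi> = ?rhs"
    by (simp add: lin_nonzero)
  then have "proots (lin p * \<chi>) = proots ?rhs" by simp
  moreover have "\<chi> \<noteq> 0"
    using degree_monic_char_poly[OF laplacian_matrix_carrier, of ?J zs] by (auto simp: \<chi>_def)
  ultimately have "add_mset (real p) (proots \<chi>) =
      {#0, real n + real p#} + replicate_mset (p - 1) (real n) + mset (map (\<lambda>e. p + e) es)"
    by (simp add: proots_mult proots_power proots_lin lin_nonzero R)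
  moreover have "laplacian_spectrum ?J = proots \<chi>"
    unfolding \<chi>_def by (rule laplacian_spectrum_eq[OF zs])
  moreover have "laplacian_spectrum G = mset es"
    using laplacian_spectrum_eq[OF xs] proots_linear_factors[of "\<lambda>e. e" es] by (simp add: es)
  ultimately show ?thesis by (simp add: n)
qed

text \<open>
  The bound on \<open>m\<close> says that the average degree \<open>d\<close> of the join is at most \<open>p\<close>, so that none of the shifted
  eigenvalues of \<open>G\<close> lies below \<open>d\<close>. Subtracting \<open>p - d\<close> compensates for the eigenvalue \<open>p\<close> that was
  added to the spectrum of the join.
\<close>

lemma laplacian_energy_join_edgeless:
  fixes G :: "'a pair_pre_digraph" and p :: nat and n m d :: real
  defines "n \<equiv> real (card (pverts G))" and "m \<equiv> real (num_edges G)"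
  defines "d \<equiv> 2 * (m + n * p) / (n + p)"
  assumes G: "pair_graph G" and "p > 0" and bound: "2 * m \<le> p * (p - n)"
  shows "laplacian_energy (graph_join G (edgeless_graph p)) =
    d + \<bar>n + p - d\<bar> + (p - 1) * \<bar>n - d\<bar> + n * (p - d) + 2 * m - (p - d)"
proof -
  interpret pair_graph G by fact
  let ?J = "graph_join G (edgeless_graph p)"
  let ?S = "laplacian_spectrum ?J"
  obtain xs where xs: "distinct xs" "set xs = pverts G"
    using finite_distinct_list[OF pair_finite_verts] by blast
  obtain es where es: "char_poly (laplacian_matrix G xs) = (\<Prod>e\<leftarrow>es. [:- e, 1:])"
    and len: "length es = card (pverts G)" and sum: "sum_list es = 2 * m"
    and nonneg: "\<And>e. e \<in> set es \<Longrightarrow> e \<ge> 0"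
    using char_poly_laplacian_factorization[OF G xs] unfolding m_def by metis
  have spec: "laplacian_spectrum G = mset es"
    using laplacian_spectrum_eq[OF xs] proots_linear_factors[of "\<lambda>e. e" es] by (simp add: es)
  have "d \<ge> 0"
    by (simp add: d_def n_def m_def)
  have "n + p > 0" using \<open>p > 0\<close> by (simp add: n_def)
  then have "d \<le> p"
    using bound by (simp add: d_def divide_simps) (simp add: algebra_simps)
  have "pverts ?J = Inl ` pverts G \<union> Inr ` {..<p}"
    by (simp add: graph_join_def edgeless_graph_def)
  then have "card (pverts ?J) = card (pverts G) + p"
    using pair_finite_verts by (simp, subst card_Un_disjoint) (auto simp: card_image)
  then have "laplacian_energy ?J = (\<Sum>\<nu>\<in>#?S. \<bar>\<nu> - d\<bar>)"
    by (simp add: laplacian_energy_def num_edges_join_edgeless[OF G] d_def n_def m_def)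
  moreover have "\<bar>p - d\<bar> + (\<Sum>\<nu>\<in>#?S. \<bar>\<nu> - d\<bar>) = (\<Sum>\<nu>\<in>#add_mset (real p) ?S. \<bar>\<nu> - d\<bar>)"
    by simp
  moreover have "\<dots> = \<bar>0 - d\<bar> + \<bar>n + p - d\<bar> + (p - 1) * \<bar>n - d\<bar> + (\<Sum>e\<leftarrow>es. \<bar>p + e - d\<bar>)"
    using \<open>p > 0\<close>
    by (simp add: laplacian_spectrum_join_edgeless[OF G] spec n_def[symmetric] of_nat_diff
          sum_mset_sum_list[symmetric] image_mset.compositionality o_def)
  moreover have "(\<Sum>e\<leftarrow>es. \<bar>p + e - d\<bar>) = (\<Sum>e\<leftarrow>es. (p - d) + e)"
    using nonneg \<open>d \<le> p\<close> by (intro arg_cong[of _ _ sum_list] map_cong) force+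
  moreover have "\<dots> = n * (p - d) + 2 * m"
    using sum by (simp add: sum_list_addf sum_list_triv len n_def)
  ultimately show ?thesis
    using \<open>d \<ge> 0\<close> \<open>d \<le> p\<close> by simp
qed

section \<open>Equality of the energies\<close>

theorem theorem4p9:
  fixes G\<^sub>1 :: "'a pair_pre_digraph" and G\<^sub>2 :: "'b pair_pre_digraph"
    and n m\<^sub>1 m\<^sub>2 p k :: nat
  assumes "pair_graph G\<^sub>1" and "pair_graph G\<^sub>2"
    and "card (pverts G\<^sub>1) = n" and "card (pverts G\<^sub>2) = n"
    and "num_edges G\<^sub>1 = m\<^sub>1" and "num_edges G\<^sub>2 = m\<^sub>2"
    and "m\<^sub>2 = 2 * m\<^sub>1"
    and "k \<ge> 4" and "p \<ge> 4 * n + k"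
    and "real m\<^sub>2 \<le> real k * (4 * real n + real k) / 8 - real n"
  shows "laplacian_energy
           (graph_join (double_graph (extended_double_cover G\<^sub>1)) (edgeless_graph p))
       = laplacian_energy
           (graph_join (extended_double_cover (extended_double_cover G\<^sub>2)) (edgeless_graph p))"
proof -
  let ?H1 = "double_graph (extended_double_cover G\<^sub>1)"
  let ?H2 = "extended_double_cover (extended_double_cover G\<^sub>2)"
  note cover1 = pair_graph_extended_double_cover[OF assms(1)]
  note cover2 = pair_graph_extended_double_cover[OF assms(2)]
  note H1 = pair_graph_double_graph[OF cover1]
  note H2 = pair_graph_extended_double_cover[OF cover2]
  have n1: "card (pverts ?H1) = 4 * n"
    using card_pverts_extended_double_cover[OF assms(1)] assms(3)
    by (simp add: double_graph_def card_cartesian_product)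
  have n2: "card (pverts ?H2) = 4 * n"
    using card_pverts_extended_double_cover[OF cover2]
      card_pverts_extended_double_cover[OF assms(2)] assms(4) by simp
  have m1: "num_edges ?H1 = 4 * n + 4 * m\<^sub>2"
    using assms(3,5,7)
    by (simp add: num_edges_double_graph[OF cover1] num_edges_extended_double_cover[OF assms(1)])
  have m2: "num_edges ?H2 = 4 * n + 4 * m\<^sub>2"
    using assms(4,6)
    by (simp add: num_edges_extended_double_cover[OF cover2]
          num_edges_extended_double_cover[OF assms(2)] card_pverts_extended_double_cover[OF assms(2)])
  have p: "real k \<le> real p - 4 * real n" "real p \<ge> 4 * real n + real k"
    using assms(9) by linarith+
  have "8 * real n + 8 * real m\<^sub>2 \<le> (4 * real n + real k) * real k"
    using assms(10) by (simp add: field_simps)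
  also have "\<dots> \<le> real p * (real p - 4 * real n)"
    using p by (intro mult_mono) auto
  finally have bound: "8 * real n + 8 * real m\<^sub>2 \<le> real p * (real p - 4 * real n)" .
  have "p > 0" using assms(8,9) by simp
  show ?thesis
    using laplacian_energy_join_edgeless[OF H1 \<open>p > 0\<close>]
      laplacian_energy_join_edgeless[OF H2 \<open>p > 0\<close>] bound
    by (simp add: n1 n2 m1 m2)
qed

end
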